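(* Let $r\ge2$ be an integer and let $H\subseteq\mathbb{N}$ be a $\Delta_r^*$-set. Then, as $N\to\infty$, \[ \frac{|H\cap[1,N]|}{N}\ge\frac{1}{r-1}\prod_{p\le r-1}\left(1-p^{-1}\right)+o(1), \] where the product runs over primes $p\le r-1$.
   Context: $\mathbb{N}$ denotes the positive integers. For a nonempty $S\subseteq\mathbb{N}$, its difference set is $\Delta(S)=\{a-b:\ a,b\in S,\ a>b\}$. A set $A\subseteq\mathbb{N}$ is a $\Delta_r^*$-set if $A\cap\Delta(S)\neq\emptyset$ for every $S\subseteq\mathbb{N}$ with $|S|\ge r$. *)

theory Defs
  imports Complex_Main "HOL-Library.Landau_Symbols" "HOL-Computational_Algebra.Primes"
begin

text \<open>The set of positive integers is \<open>{0<..} :: nat set\<close>.\<close>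

definition difference_set :: "nat set \<Rightarrow> nat set" where
  "difference_set S = {a - b | a b. a \<in> S \<and> b \<in> S \<and> a > b}"

text \<open>The condition that \<open>S\<close> has at least \<open>r\<close> elements includes infinite \<open>S\<close>, for which
  \<open>card S = 0\<close>.\<close>

definition Delta_star_set :: "nat \<Rightarrow> nat set \<Rightarrow> bool" where
  "Delta_star_set r A \<longleftrightarrow>
     A \<subseteq> {0<..} \<and>
     (\<forall>S. S \<subseteq> {0<..} \<and> (infinite S \<or> card S \<ge> r) \<longrightarrow> A \<inter> difference_set S \<noteq> {})"

end

theory Submission
  imports Defs "HOL-Number_Theory.Totient" "HOL-Real_Asymp.Real_Asymp"
begin

text \<open>Applied to \<open>{m, 2m, \<dots>, rm}\<close>, the hypothesis puts some multiple \<open>jm\<close> with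
  \<open>1 \<le> j \<le> r - 1\<close> in \<open>H\<close>, for every positive \<open>m\<close>. If \<open>m\<close> ranges over the integers
  coprime to \<open>(r - 1)!\<close>, then \<open>jm\<close> determines \<open>m\<close>, so \<open>H\<close> has at least as many elements
  up to \<open>N\<close> as there are such \<open>m\<close> up to \<open>N / (r - 1)\<close>; these have
  density \<open>\<Prod>p\<le>r-1. 1 - 1/p\<close>.\<close>

lemma Delta_star_set_multiple:
  assumes "Delta_star_set r H" "m > 0"
  shows "\<exists>j\<in>{1..r - 1}. j * m \<in> H"
proof -
  define S where "S = (\<lambda>i. i * m) ` {1..r}"
  have "card S = r"
    unfolding S_def using assms(2) by (subst card_image) (auto simp: inj_on_def)
  moreover have "S \<subseteq> {0<..}"
    using assms(2) by (auto simp: S_def)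
  ultimately have "H \<inter> difference_set S \<noteq> {}"
    using assms(1) unfolding Delta_star_set_def by simp
  then obtain i k where ik: "i \<in> {1..r}" "k \<in> {1..r}" "i * m > k * m" "i * m - k * m \<in> H"
    unfolding difference_set_def S_def by auto
  then have "k < i" and "(i - k) * m \<in> H"
    by (auto simp: diff_mult_distrib)
  with ik show ?thesis
    by (intro bexI[of _ "i - k"]) auto
qed

text \<open>Since \<open>j\<close> divides \<open>fact n\<close>, it is coprime to
  \<open>m'\<close>, so \<open>j dvd j' * m'\<close> forces \<open>j dvd j'\<close>. By symmetry
  \<open>j = j'\<close>, and this factor cancels. This gives the injectivity needed for the
  counting.\<close>

lemma rough_times_smooth_unique:
  fixes m m' j j' n :: nat
  assumes "coprime m (fact n)" "coprime m' (fact n)" "j \<in> {1..n}" "j' \<in> {1..n}"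
    and eq: "j * m = j' * m'"
  shows "m = m'"
proof -
  have "j dvd fact n" "j' dvd fact n"
    using assms(3,4) by (auto intro: dvd_fact)
  then have "coprime j m'" "coprime j' m"
    using assms(1,2) by (meson coprime_commute coprime_divisors dvd_refl)+
  then have "j dvd j'" "j' dvd j"
    using eq by (metis coprime_dvd_mult_left_iff dvd_triv_left)+
  then have "j = j'"
    by (rule dvd_antisym)
  then show ?thesis
    using eq assms(3) by simp
qed

text \<open>Coprimality to \<open>q\<close> is periodic with period \<open>q\<close>, so each
  further block of length \<open>q\<close> is a translate of \<open>totatives q\<close>.\<close>

lemma card_coprime_multiple:
  "card {m \<in> {0<..k * q}. coprime m q} = k * totient q" for k q :: nat
proof (induction k)
  case (Suc k)
  have shift: "coprime (m + k * q) q \<longleftrightarrow> coprime m q" for m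
    using gcd_add_mult[of q k m] unfolding coprime_iff_gcd_eq_1
    by (metis add.commute gcd.commute)
  have "{m \<in> {0<..Suc k * q}. coprime m q} =
      {m \<in> {0<..k * q}. coprime m q} \<union> (\<lambda>m. m + k * q) ` totatives q" (is "_ = ?A \<union> ?B")
  proof (intro equalityI subsetI)
    fix m assume m: "m \<in> {m \<in> {0<..Suc k * q}. coprime m q}"
    show "m \<in> ?A \<union> ?B"
    proof (cases "m \<le> k * q")
      case False
      then obtain n where n: "m = n + k * q" "n > 0"
        by (metis add.commute less_imp_add_positive not_le)
      then have "n \<in> totatives q"
        using m by (auto simp: totatives_def shift)
      then show ?thesis using n by blast
    qed (use m in auto)
  next
    fix m assume "m \<in> ?A \<union> ?B"
    then show "m \<in> {m \<in> {0<..Suc k * q}. coprime m q}"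
      by (auto simp: totatives_def shift)
  qed
  moreover have "card (?A \<union> ?B) = card ?A + card ?B"
    by (rule card_Un_disjoint) (auto simp: totatives_def)
  moreover have "card ?B = totient q"
    by (subst card_image) (auto simp: totient_def)
  ultimately show ?case
    using Suc.IH by simp
qed simp

text \<open>Euler's product formula: the primes dividing \<open>fact n\<close> are exactly those up
  to \<open>n\<close>.\<close>

lemma totient_fact_div_fact:
  "real (totient (fact n)) / fact n = (\<Prod>p | prime p \<and> p \<le> n. 1 - 1 / real p)"
proof -
  have "prime_factors (fact n :: nat) = {p. prime p \<and> p \<le> n}"
    by (auto simp: prime_factors_dvd prime_dvd_fact_iff)
  then show ?thesis
    by (simp add: totient_formula2)
qed

lemma Delta_star_set_card_ge:
  assumes "Delta_star_set r H"
  shows "card (H \<inter> {1..N}) \<ge> N div ((r - 1) * fact (r - 1)) * totient (fact (r - 1))"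
proof -
  define q :: nat where "q = fact (r - 1)"
  \<comment> \<open>As \<open>j m\<close> can be as large as \<open>r - 1\<close>, only
    \<open>m\<close> up to \<open>N / (r - 1)\<close> are safe. Here \<open>k * q\<close> is the
    largest multiple of \<open>q\<close> in that range, and whole periods make the count
    exact.\<close>
  define k where "k = N div ((r - 1) * q)"
  define M where "M = {m \<in> {0<..k * q}. coprime m q}"
  obtain j where j: "\<And>m. m > 0 \<Longrightarrow> j m \<in> {1..r - 1} \<and> j m * m \<in> H"
    using Delta_star_set_multiple[OF assms] by metis
  have "inj_on (\<lambda>m. j m * m) M"
  proof (rule inj_onI)
    fix m m' assume "m \<in> M" "m' \<in> M" and eq: "j m * m = j m' * m'"
    then have "coprime m (fact (r - 1))" "coprime m' (fact (r - 1))" "m > 0" "m' > 0"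
      by (simp_all add: M_def q_def)
    then show "m = m'"
      using rough_times_smooth_unique[OF _ _ _ _ eq] j by blast
  qed
  moreover have "(\<lambda>m. j m * m) ` M \<subseteq> H \<inter> {1..N}"
  proof clarify
    fix m assume m: "m \<in> M"
    then have "m > 0" "m \<le> k * q" by (auto simp: M_def)
    have "j m * m \<le> (r - 1) * (k * q)"
      using j \<open>m > 0\<close> \<open>m \<le> k * q\<close> by (intro mult_mono) auto
    also have "\<dots> = k * ((r - 1) * q)" by simp
    also have "\<dots> \<le> N" by (simp only: k_def div_times_less_eq_dividend)
    finally show "j m * m \<in> H \<inter> {1..N}"
      using j[OF \<open>m > 0\<close>] \<open>m > 0\<close> by auto
  qed
  ultimately have "card M \<le> card (H \<inter> {1..N})"
    by (intro card_inj_on_le) auto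
  then show ?thesis
    by (simp only: M_def card_coprime_multiple) (simp only: k_def q_def)
qed

theorem mainTheorem5:
  fixes r :: nat and H :: "nat set"
  assumes "r \<ge> 2" and "Delta_star_set r H"
  shows "\<exists>e :: nat \<Rightarrow> real. e \<in> o(\<lambda>_. 1) \<and>
    (\<forall>N\<ge>1. real (card (H \<inter> {1..N})) / real N \<ge>
       1 / real (r - 1) * (\<Prod>p | prime p \<and> p \<le> r - 1. 1 - 1 / real p) + e N)"
proof (intro exI conjI allI impI)
  define t where "t = totient (fact (r - 1))"
  \<comment> \<open>Rounding \<open>N / d\<close> down to an integer costs less than one period,
    hence at most \<open>t\<close> elements of the count. Dividing by \<open>N\<close> gives this
    error term.\<close>
  show "(\<lambda>N. - real t / real N) \<in> o(\<lambda>_. 1)"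
    by real_asymp
  fix N :: nat assume N: "N \<ge> 1"
  define d :: nat where "d = (r - 1) * fact (r - 1)"
  have "real N / real d - 1 \<le> real (N div d)"
    using floor_divide_of_nat_eq[of N d, where 'a = real] by linarith
  then have "(real N / real d - 1) * real t \<le> real (N div d) * real t"
    by (rule mult_right_mono) simp
  also have "\<dots> \<le> real (card (H \<inter> {1..N}))"
    using Delta_star_set_card_ge[OF assms(2), of N]
    unfolding t_def d_def of_nat_mult[symmetric] of_nat_le_iff .
  finally have "(real N / real d - 1) * real t / real N \<le> real (card (H \<inter> {1..N})) / real N"
    by (rule divide_right_mono) simp
  moreover have "(real N / real d - 1) * real t / real N = real t / real d + - real t / real N"
    using N by (simp add: field_simps)
  \<comment> \<open>The factor \<open>r - 1\<close> of \<open>d\<close> yields the leading fraction,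
    and its factor \<open>fact (r - 1)\<close> turns \<open>t\<close> into the Euler
    product.\<close>
  moreover have "real t / real d =
      1 / real (r - 1) * (\<Prod>p | prime p \<and> p \<le> r - 1. 1 - 1 / real p)"
    by (simp add: totient_fact_div_fact[symmetric] t_def d_def)
  ultimately show "real (card (H \<inter> {1..N})) / real N \<ge>
      1 / real (r - 1) * (\<Prod>p | prime p \<and> p \<le> r - 1. 1 - 1 / real p) + - real t / real N"
    by simp
qed

end
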